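(* Let $Q$ be a smooth manifold, let $\mathcal{D}$ be an open subset of $\mathbb{R}^n\times TQ$, and let $F\in C^\infty(\mathcal{D})$ be a 1-homogeneous, $\mathbb{R}^n$-regular Lagrangian. Let $\mu=(\mu_a)\in\mathbb{R}^n$, let $U\subset TQ$ be open and let $\iota_\mu:U\to\mathcal{D}$, $(x^i,y^i)\mapsto(y^a=\iota_\mu^a(x^i,y^i),x^i,y^i)$, be a smooth map with $\frac{\partial F}{\partial y^a}\circ\iota_\mu=\mu_a$ for all $a$. Then the Routhian $F_\mu=(F\circ\iota_\mu)-\mu_a\iota^a_\mu$ is a 1-homogeneous function on $U$, i.e. $\Delta_Q(F_\mu)=F_\mu$ where $\Delta_Q=y^i\,\partial/\partial y^i$.
   Context: Let $M=\mathbb{R}^n\times Q$ with coordinates $(x^\alpha)=(x^a,x^i)$, and induced coordinates $(x^\alpha,y^\alpha)$ on $TM$. A Lagrangian which does not depend on the coordinates $x^a$ of $\mathbb{R}^n$ (i.e. which is invariant under the translation action of $\mathbb{R}^n$) is identified with a function on (an open subset of) the quotient $TM/\mathbb{R}^n=\mathbb{R}^n\times TQ$, with coordinates $(y^a,x^i,y^i)$. Summation over repeated indices is understood. $F$ is 1-homogeneous if $\Delta_M(F)=F$, where $\Delta_M=y^\alpha\partial/\partial y^\alpha=y^a\partial/\partial y^a+y^i\partial/\partial y^i$. $F$ is $\mathbb{R}^n$-regular if the $n\times n$ matrix $(\partial^2F/\partial y^a\partial y^b)$ is everywhere non-singular on its domain. The function $F_\mu$ is called the Routhian of $F$ at the momentum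 level $\mu$. *)

theory Defs
  imports "HOL-Analysis.Analysis"
begin

section \<open>Smooth functions and smooth manifolds\<close>

fun times_differentiable_on ::
  "nat \<Rightarrow> 'a::real_normed_vector set \<Rightarrow> ('a \<Rightarrow> 'b::real_normed_vector) \<Rightarrow> bool" where
  "times_differentiable_on 0 S f \<longleftrightarrow> continuous_on S f"
| "times_differentiable_on (Suc k) S f \<longleftrightarrow>
     (\<forall>x\<in>S. f differentiable (at x)) \<and>
     (\<forall>h. times_differentiable_on k S (\<lambda>x. frechet_derivative f (at x) h))"

text \<open>To be used for open sets of finite-dimensional spaces only: there, the condition on
  directional derivatives above is the usual definition of class \<open>C\<^sup>k\<close>.\<close>

definition smooth_on :: "'a::real_normed_vector set \<Rightarrow> ('a \<Rightarrow> 'b::real_normed_vector) \<Rightarrow> bool" where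
  "smooth_on S f \<longleftrightarrow> (\<forall>k. times_differentiable_on k S f)"

text \<open>A chart is a pair of a domain and a map, whose values outside the domain are irrelevant.
  The model space \<open>'e\<close> of a manifold is a finite-dimensional normed space with a chosen basis
  \<open>B\<close>, so that a point \<open>p\<close> has the coordinates \<open>representation B (\<phi> p) i\<close> for \<open>i \<in> B\<close>.
  Unlike the class \<open>euclidean_space\<close>, this does not exclude manifolds of dimension zero.\<close>

type_synonym ('q, 'e) chart = "'q set \<times> ('q \<Rightarrow> 'e)"

definition chart_inv :: "('q, 'e) chart \<Rightarrow> 'e \<Rightarrow> 'q" where
  "chart_inv c = inv_into (fst c) (snd c)"

definition is_chart :: "'q topology \<Rightarrow> ('q, 'e::real_normed_vector) chart \<Rightarrow> bool" where
  "is_chart Q c \<longleftrightarrow> openin Q (fst c) \<and> open (snd c ` fst c) \<and>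
     homeomorphic_map (subtopology Q (fst c)) (top_of_set (snd c ` fst c)) (snd c)"

definition transition :: "('q, 'e) chart \<Rightarrow> ('q, 'e) chart \<Rightarrow> 'e \<Rightarrow> 'e" where
  "transition c d = snd d \<circ> chart_inv c"

definition smooth_manifold ::
  "'e::real_normed_vector set \<Rightarrow> 'q topology \<Rightarrow> ('q, 'e) chart set \<Rightarrow> bool" where
  "smooth_manifold B Q A \<longleftrightarrow>
     finite B \<and> independent B \<and> span B = UNIV \<and>
     Hausdorff_space Q \<and> second_countable Q \<and>
     (\<forall>c\<in>A. is_chart Q c) \<and> (\<Union>c\<in>A. fst c) = topspace Q \<and>
     (\<forall>c\<in>A. \<forall>d\<in>A. smooth_on (snd c ` (fst c \<inter> fst d)) (transition c d))"

section \<open>The tangent bundle\<close>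

text \<open>A tangent vector at \<open>p\<close> is a family of components \<open>v c\<close>, one for each chart \<open>c\<close> around
  \<open>p\<close>, which transform with the derivative of the transition maps. The entries at
  all other pairs \<open>c\<close> are set to zero, so that equality of tangent vectors is equality in HOL.\<close>

type_synonym ('q, 'e) tangent = "'q \<times> (('q, 'e) chart \<Rightarrow> 'e)"

definition charts_at :: "('q, 'e) chart set \<Rightarrow> 'q \<Rightarrow> ('q, 'e) chart set" where
  "charts_at A p = {c \<in> A. p \<in> fst c}"

definition tangent_bundle ::
  "'q topology \<Rightarrow> ('q, 'e::real_normed_vector) chart set \<Rightarrow> ('q, 'e) tangent set" where
  "tangent_bundle Q A = {(p, v). p \<in> topspace Q \<and>
     (\<forall>c\<in>charts_at A p. \<forall>d\<in>charts_at A p.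
        v d = frechet_derivative (transition c d) (at (snd c p)) (v c)) \<and>
     (\<forall>c. c \<notin> charts_at A p \<longrightarrow> v c = 0)}"

text \<open>The induced chart \<open>(x, y)\<close> of the tangent bundle over the domain of \<open>c\<close>, and its inverse.\<close>

definition tcoord :: "('q, 'e) chart \<Rightarrow> ('q, 'e) tangent \<Rightarrow> 'e \<times> 'e" where
  "tcoord c w = (snd c (fst w), snd w c)"

definition tcoord_inv ::
  "'q topology \<Rightarrow> ('q, 'e::real_normed_vector) chart set \<Rightarrow> ('q, 'e) chart \<Rightarrow> 'e \<times> 'e \<Rightarrow> ('q, 'e) tangent"
  where "tcoord_inv Q A c = inv_into {w \<in> tangent_bundle Q A. fst w \<in> fst c} (tcoord c)"

definition tangent_topology ::
  "'q topology \<Rightarrow> ('q, 'e::real_normed_vector) chart set \<Rightarrow> ('q, 'e) tangent topology" where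
  "tangent_topology Q A = topology (\<lambda>W. W \<subseteq> tangent_bundle Q A \<and>
     (\<forall>c\<in>A. open (tcoord c ` {w \<in> W. fst w \<in> fst c})))"

section \<open>Functions on open subsets of \<open>TQ\<close> and of \<open>\<real>\<^sup>n \<times> TQ\<close>\<close>

definition smooth_on_TQ ::
  "'q topology \<Rightarrow> ('q, 'e::real_normed_vector) chart set \<Rightarrow> ('q, 'e) tangent set \<Rightarrow>
   (('q, 'e) tangent \<Rightarrow> 'b::real_normed_vector) \<Rightarrow> bool" where
  "smooth_on_TQ Q A U f \<longleftrightarrow>
     (\<forall>c\<in>A. smooth_on (tcoord c ` {w \<in> U. fst w \<in> fst c}) (f \<circ> tcoord_inv Q A c))"

definition smooth_on_RnTQ ::
  "'q topology \<Rightarrow> ('q, 'e::real_normed_vector) chart set \<Rightarrow> ((real ^ 'n) \<times> ('q, 'e) tangent) set \<Rightarrow>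
   ((real ^ 'n) \<times> ('q, 'e) tangent \<Rightarrow> 'b::real_normed_vector) \<Rightarrow> bool" where
  "smooth_on_RnTQ Q A D F \<longleftrightarrow>
     (\<forall>c\<in>A. smooth_on (map_prod id (tcoord c) ` {(y, w) \<in> D. fst w \<in> fst c})
       (F \<circ> map_prod id (tcoord_inv Q A c)))"

text \<open>The partial derivatives \<open>\<partial>/\<partial>y\<^sup>a\<close> on \<open>\<real>\<^sup>n \<times> TQ\<close> and, in the chart induced by \<open>c\<close>,
  \<open>\<partial>/\<partial>y\<^sup>i\<close> on \<open>TQ\<close>, with \<open>i \<in> B\<close>.\<close>

definition partial_a :: "'n \<Rightarrow> ((real ^ 'n) \<times> 'w \<Rightarrow> real) \<Rightarrow> (real ^ 'n) \<times> 'w \<Rightarrow> real" where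
  "partial_a a F = (\<lambda>(y, w). deriv (\<lambda>t. F (y + t *\<^sub>R axis a 1, w)) 0)"

definition partial_i ::
  "'q topology \<Rightarrow> ('q, 'e::real_normed_vector) chart set \<Rightarrow> ('q, 'e) chart \<Rightarrow> 'e \<Rightarrow>
   (('q, 'e) tangent \<Rightarrow> real) \<Rightarrow> ('q, 'e) tangent \<Rightarrow> real" where
  "partial_i Q A c i f w =
     deriv (\<lambda>t. f (tcoord_inv Q A c (snd c (fst w), snd w c + t *\<^sub>R i))) 0"

text \<open>The Liouville fields \<open>\<Delta>\<^sub>Q\<close> and \<open>\<Delta>\<^sub>M\<close>, the latter acting on functions that do not depend on the
  base coordinates \<open>x\<^sup>a\<close>, as expressed in the chart induced by \<open>c\<close>.\<close>

definition Delta_Q ::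
  "'e set \<Rightarrow> 'q topology \<Rightarrow> ('q, 'e::real_normed_vector) chart set \<Rightarrow> ('q, 'e) chart \<Rightarrow>
   (('q, 'e) tangent \<Rightarrow> real) \<Rightarrow> ('q, 'e) tangent \<Rightarrow> real" where
  "Delta_Q B Q A c f w =
     (\<Sum>i\<in>B. representation B (snd w c) i * partial_i Q A c i f w)"

definition Delta_M ::
  "'e set \<Rightarrow> 'q topology \<Rightarrow> ('q, 'e::real_normed_vector) chart set \<Rightarrow> ('q, 'e) chart \<Rightarrow>
   ((real ^ 'n) \<times> ('q, 'e) tangent \<Rightarrow> real) \<Rightarrow> (real ^ 'n) \<times> ('q, 'e) tangent \<Rightarrow> real" where
  "Delta_M B Q A c F = (\<lambda>(y, w).
     (\<Sum>a\<in>UNIV. y $ a * partial_a a F (y, w)) +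
     (\<Sum>i\<in>B. representation B (snd w c) i * partial_i Q A c i (\<lambda>w'. F (y, w')) w))"

definition homogeneous1_on_TQ ::
  "'e set \<Rightarrow> 'q topology \<Rightarrow> ('q, 'e::real_normed_vector) chart set \<Rightarrow> ('q, 'e) tangent set \<Rightarrow>
   (('q, 'e) tangent \<Rightarrow> real) \<Rightarrow> bool" where
  "homogeneous1_on_TQ B Q A U f \<longleftrightarrow>
     (\<forall>c\<in>A. \<forall>w\<in>U. fst w \<in> fst c \<longrightarrow> Delta_Q B Q A c f w = f w)"

definition homogeneous1_on_RnTQ ::
  "'e set \<Rightarrow> 'q topology \<Rightarrow> ('q, 'e::real_normed_vector) chart set \<Rightarrow>
   ((real ^ 'n) \<times> ('q, 'e) tangent) set \<Rightarrow> ((real ^ 'n) \<times> ('q, 'e) tangent \<Rightarrow> real) \<Rightarrow> bool" where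
  "homogeneous1_on_RnTQ B Q A D F \<longleftrightarrow>
     (\<forall>c\<in>A. \<forall>(y, w)\<in>D. fst w \<in> fst c \<longrightarrow> Delta_M B Q A c F (y, w) = F (y, w))"

definition Rn_regular_on ::
  "((real ^ 'n) \<times> 'w) set \<Rightarrow> ((real ^ 'n) \<times> 'w \<Rightarrow> real) \<Rightarrow> bool" where
  "Rn_regular_on D F \<longleftrightarrow>
     (\<forall>z\<in>D. invertible ((\<chi> a b. partial_a a (partial_a b F) z) :: real ^ 'n ^ 'n))"

text \<open>The argument \<open>\<iota>\<close> consists of the components \<open>\<iota>\<^sup>a\<close> of the map \<open>\<iota>\<^sub>\<mu>\<close>, which sends \<open>w\<close> to
  \<open>(\<iota> w, w)\<close>.\<close>

definition Routhian ::
  "((real ^ 'n) \<times> 'w \<Rightarrow> real) \<Rightarrow> real ^ 'n \<Rightarrow> ('w \<Rightarrow> real ^ 'n) \<Rightarrow> 'w \<Rightarrow> real" where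
  "Routhian F \<mu> \<iota> w = F (\<iota> w, w) - (\<Sum>a\<in>UNIV. \<mu> $ a * \<iota> w $ a)"

end

theory Submission
  imports Defs
begin

text \<open>In an induced chart, differentiate \<open>s \<mapsto> F (\<iota> s, s) - \<mu>\<^sub>a \<iota>\<^sup>a s\<close> by the chain rule.
  Since \<open>\<partial>F/\<partial>y\<^sup>a = \<mu>\<^sub>a\<close> along \<open>\<iota>\<close>, the terms containing derivatives of \<open>\<iota>\<close> cancel, so that
  \<open>\<partial>F\<^sub>\<mu>/\<partial>y\<^sup>i\<close> is \<open>\<partial>F/\<partial>y\<^sup>i\<close> at \<open>\<iota>\<close>. Hence \<open>\<Delta>\<^sub>Q F\<^sub>\<mu>\<close> is \<open>\<Delta>\<^sub>M F - \<mu>\<^sub>a \<iota>\<^sup>a = F - \<mu>\<^sub>a \<iota>\<^sup>a\<close>.\<close>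

section \<open>Smoothness and the induced charts of the tangent bundle\<close>

lemma smooth_on_imp_differentiable:
  assumes "smooth_on S f" "x \<in> S"
  shows "f differentiable (at x)"
proof -
  have "times_differentiable_on (Suc 0) S f"
    using assms(1) unfolding smooth_on_def by blast
  then show ?thesis using assms(2) by simp
qed

lemma tangent_bundle_transform:
  assumes "w \<in> tangent_bundle Q A" "c \<in> charts_at A (fst w)" "d \<in> charts_at A (fst w)"
  shows "snd w d = frechet_derivative (transition c d) (at (snd c (fst w))) (snd w c)"
  using assms unfolding tangent_bundle_def mem_Collect_eq case_prod_unfold by blast

lemma tangent_bundle_eq_0:
  assumes "w \<in> tangent_bundle Q A" "c \<notin> charts_at A (fst w)"
  shows "snd w c = 0"
  using assms unfolding tangent_bundle_def mem_Collect_eq case_prod_unfold by blast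

text \<open>A tangent vector is recovered from its base point and a single component: the transition
  law yields its components in the other charts around the point, and all remaining entries are zero
  by convention. The base point itself is recovered because a chart is injective on its
  domain.\<close>

lemma inj_on_tcoord:
  assumes "is_chart Q c" "c \<in> A"
  shows "inj_on (tcoord c) {w \<in> tangent_bundle Q A. fst w \<in> fst c}"
proof (rule inj_onI)
  fix w w'
  assume w: "w \<in> {w \<in> tangent_bundle Q A. fst w \<in> fst c}"
    and w': "w' \<in> {w \<in> tangent_bundle Q A. fst w \<in> fst c}"
    and eq: "tcoord c w = tcoord c w'"
  \<comment> \<open>This makes the topspace of \<open>subtopology Q (fst c)\<close> equal to
    \<open>fst c\<close>, the set on which injectivity is wanted.\<close>
  have "fst c \<subseteq> topspace Q"
    using assms(1) by (simp add: is_chart_def openin_subset)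
  moreover have "inj_on (snd c) (topspace (subtopology Q (fst c)))"
    using assms(1) unfolding is_chart_def
    by (meson homeomorphic_imp_injective_map)
  ultimately have "inj_on (snd c) (fst c)"
    by (simp add: Int_absorb1)
  then have p: "fst w = fst w'"
    using w w' eq by (auto simp: tcoord_def dest: inj_onD)
  have c: "c \<in> charts_at A (fst w)"
    using w assms(2) by (simp add: charts_at_def)
  have "snd w d = snd w' d" for d
  proof (cases "d \<in> charts_at A (fst w)")
    case True
    then show ?thesis
      using tangent_bundle_transform[of w Q A c d] tangent_bundle_transform[of w' Q A c d]
        w w' c p eq by (simp add: tcoord_def)
  next
    case False
    then show ?thesis
      using tangent_bundle_eq_0[of w Q A d] tangent_bundle_eq_0[of w' Q A d] w w' p by simp
  qed
  then show "w = w'" using p by (simp add: prod_eq_iff fun_eq_iff)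
qed

lemma tcoord_inv_tcoord:
  assumes "is_chart Q c" "c \<in> A" "w \<in> tangent_bundle Q A" "fst w \<in> fst c"
  shows "tcoord_inv Q A c (tcoord c w) = w"
  unfolding tcoord_inv_def using assms inj_on_tcoord[OF assms(1,2)]
  by (intro inv_into_f_f) auto

text \<open>The constructor \<open>topology\<close> can be unfolded once its predicate is shown to
  be closed under binary intersections and arbitrary unions. Unions commute with images in general;
  intersections do so here because \<open>tcoord c\<close> is injective over the domain of
  \<open>c\<close>.\<close>

lemma openin_tangent_topology:
  assumes "\<And>c. c \<in> A \<Longrightarrow> is_chart Q c"
  shows "openin (tangent_topology Q A) W \<longleftrightarrow> W \<subseteq> tangent_bundle Q A \<and>
     (\<forall>c\<in>A. open (tcoord c ` {w \<in> W. fst w \<in> fst c}))"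
proof -
  let ?P = "\<lambda>W. W \<subseteq> tangent_bundle Q A \<and>
     (\<forall>c\<in>A. open (tcoord c ` {w \<in> W. fst w \<in> fst c}))"
  have "istopology ?P"
    unfolding istopology_def
  proof (intro conjI allI impI)
    fix S T assume S: "?P S" and T: "?P T"
    show "S \<inter> T \<subseteq> tangent_bundle Q A" using S by blast
    show "\<forall>c\<in>A. open (tcoord c ` {w \<in> S \<inter> T. fst w \<in> fst c})"
    proof
      fix c assume c: "c \<in> A"
      have "tcoord c ` ({w \<in> S. fst w \<in> fst c} \<inter> {w \<in> T. fst w \<in> fst c})
          = tcoord c ` {w \<in> S. fst w \<in> fst c} \<inter> tcoord c ` {w \<in> T. fst w \<in> fst c}"
        using S T by (intro inj_on_image_Int[OF inj_on_tcoord[OF assms[OF c] c]]) auto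
      moreover have "{w \<in> S \<inter> T. fst w \<in> fst c}
          = {w \<in> S. fst w \<in> fst c} \<inter> {w \<in> T. fst w \<in> fst c}" by blast
      ultimately show "open (tcoord c ` {w \<in> S \<inter> T. fst w \<in> fst c})"
        using S T c by (simp add: open_Int)
    qed
  next
    fix \<K> assume K: "\<forall>K\<in>\<K>. ?P K"
    show "\<Union>\<K> \<subseteq> tangent_bundle Q A" using K by blast
    show "\<forall>c\<in>A. open (tcoord c ` {w \<in> \<Union>\<K>. fst w \<in> fst c})"
    proof
      fix c assume c: "c \<in> A"
      have "tcoord c ` {w \<in> \<Union>\<K>. fst w \<in> fst c}
          = (\<Union>K\<in>\<K>. tcoord c ` {w \<in> K. fst w \<in> fst c})" by blast
      then show "open (tcoord c ` {w \<in> \<Union>\<K>. fst w \<in> fst c})"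
        using K c by (simp add: open_UN)
    qed
  qed
  then show ?thesis
    unfolding tangent_topology_def by simp
qed

section \<open>Derivatives on the model space\<close>

lemma linear_eq_sum_axis:
  fixes f :: "real ^ 'n \<Rightarrow> real"
  assumes "linear f"
  shows "f y = (\<Sum>a\<in>UNIV. y $ a * f (axis a 1))"
proof -
  have "f y = f (\<Sum>a\<in>UNIV. y $ a *\<^sub>R axis a 1)"
    using basis_expansion[of y] by (simp add: scalar_mult_eq_scaleR)
  also have "\<dots> = (\<Sum>a\<in>UNIV. y $ a * f (axis a 1))"
    using assms by (simp add: linear_sum linear_cmul)
  finally show ?thesis .
qed

text \<open>The chain rule gives \<open>G' (J' h, h)\<close> for the first term. By linearity this
  is \<open>G' (J' h, 0) + G' (0, h)\<close>, and the assumption on \<open>\<mu>\<close> makes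
  \<open>G' (J' h, 0)\<close> exactly the derivative of the subtracted sum.\<close>

lemma has_derivative_legendre:
  fixes G :: "(real ^ 'n) \<times> 's::real_normed_vector \<Rightarrow> real"
  assumes G: "(G has_derivative G') (at (J s, s))"
    and J: "(J has_derivative J') (at s)"
    and \<mu>: "\<And>a. G' (axis a 1, 0) = \<mu> $ a"
  shows "((\<lambda>s. G (J s, s) - (\<Sum>a\<in>UNIV. \<mu> $ a * J s $ a)) has_derivative (\<lambda>h. G' (0, h))) (at s)"
proof -
  have lin: "linear G'" using G by (rule has_derivative_linear)
  have lin_fst: "linear (\<lambda>y. G' (y, 0))"
  proof (rule linearI)
    show "G' (x + y, 0) = G' (x, 0) + G' (y, 0)" for x y
      using linear_add[OF lin, of "(x, 0)" "(y, 0)"] by simp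
    show "G' (r *\<^sub>R x, 0) = r *\<^sub>R G' (x, 0)" for r x
      using linear_cmul[OF lin, of r "(x, 0)"] by simp
  qed
  have split: "G' (y, h) = (\<Sum>a\<in>UNIV. \<mu> $ a * y $ a) + G' (0, h)" for y h
    using linear_add[OF lin, of "(y, 0)" "(0, h)"] linear_eq_sum_axis[OF lin_fst, of y]
    by (simp add: \<mu> mult.commute)
  have "((\<lambda>s. (J s, s)) has_derivative (\<lambda>h. (J' h, h))) (at s)"
    by (intro has_derivative_Pair J has_derivative_ident)
  then have 1: "((\<lambda>s. G (J s, s)) has_derivative (\<lambda>h. G' (J' h, h))) (at s)"
    by (rule has_derivative_compose) (rule G)
  have "((\<lambda>s. J s $ a) has_derivative (\<lambda>h. J' h $ a)) (at s)" for a
    by (rule bounded_linear.has_derivative[OF bounded_linear_vec_nth J])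
  then have "((\<lambda>s. \<Sum>a\<in>UNIV. \<mu> $ a * J s $ a) has_derivative
      (\<lambda>h. \<Sum>a\<in>UNIV. \<mu> $ a * J' h $ a)) (at s)"
    by (intro has_derivative_sum has_derivative_mult_right)
  from has_derivative_diff[OF 1 this] show ?thesis
    by (simp add: split[of "J' h" h for h])
qed

lemma deriv_along_line:
  fixes g :: "'s::real_normed_vector \<Rightarrow> real"
  assumes "(g has_derivative g') (at s)"
  shows "deriv (\<lambda>t. g (s + t *\<^sub>R u)) 0 = g' u"
proof -
  have "((\<lambda>t. s + t *\<^sub>R u) has_derivative (\<lambda>t. t *\<^sub>R u)) (at 0)"
    by (auto intro!: derivative_eq_intros)
  then have "((\<lambda>t. g (s + t *\<^sub>R u)) has_derivative (\<lambda>t. g' (t *\<^sub>R u))) (at 0)"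
    by (rule has_derivative_compose) (use assms in simp)
  \<comment> \<open>Linearity of \<open>g'\<close> turns
    \<open>t \<mapsto> g' (t *\<^sub>R u)\<close> into multiplication by the number
    \<open>g' u\<close>, the form that \<open>deriv\<close> requires.\<close>
  then have "((\<lambda>t. g (s + t *\<^sub>R u)) has_field_derivative g' u) (at 0)"
    using linear_cmul[OF has_derivative_linear[OF assms]]
    by (simp add: has_field_derivative_def mult_commute_abs)
  then show ?thesis by (rule DERIV_imp_deriv)
qed

section \<open>Partial derivatives read off in an induced chart\<close>

text \<open>\<open>partial_a\<close> is defined without charts, but its line keeps \<open>w\<close>
  fixed, so it becomes a line in the chart as soon as \<open>tcoord_inv\<close> returns this one
  \<open>w\<close>.\<close>

lemma partial_a_chart:
  assumes "tcoord_inv Q A c (tcoord c w) = w"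
    and "((F \<circ> map_prod id (tcoord_inv Q A c)) has_derivative G') (at (y, tcoord c w))"
  shows "partial_a a F (y, w) = G' (axis a 1, 0)"
  using deriv_along_line[OF assms(2), of "(axis a 1, 0)"] assms(1)
  by (simp add: partial_a_def)

lemma partial_i_chart:
  assumes "((f \<circ> tcoord_inv Q A c) has_derivative f') (at (tcoord c w))"
  shows "partial_i Q A c i f w = f' (0, i)"
  using deriv_along_line[OF assms, of "(0, i)"]
  by (simp add: partial_i_def tcoord_def)

theorem proposition3:
  fixes Q :: "'q topology"
    and A :: "('q, 'e::real_normed_vector) chart set"
    and B :: "'e set"
    and D :: "((real ^ 'n) \<times> ('q, 'e) tangent) set"
    and F :: "(real ^ 'n) \<times> ('q, 'e) tangent \<Rightarrow> real"
    and \<mu> :: "real ^ 'n"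
    and U :: "('q, 'e) tangent set"
    and \<iota> :: "('q, 'e) tangent \<Rightarrow> real ^ 'n"
  assumes "smooth_manifold B Q A"
    and "openin (prod_topology euclidean (tangent_topology Q A)) D"
    and "smooth_on_RnTQ Q A D F"
    and "homogeneous1_on_RnTQ B Q A D F"
    and "Rn_regular_on D F"
    and "openin (tangent_topology Q A) U"
    and "\<And>w. w \<in> U \<Longrightarrow> (\<iota> w, w) \<in> D"
    and "smooth_on_TQ Q A U \<iota>"
    and "\<And>w a. w \<in> U \<Longrightarrow> partial_a a F (\<iota> w, w) = \<mu> $ a"
  shows "homogeneous1_on_TQ B Q A U (Routhian F \<mu> \<iota>)"
  unfolding homogeneous1_on_TQ_def
proof (intro ballI impI)
  fix c w
  assume c: "c \<in> A" and w: "w \<in> U" and wc: "fst w \<in> fst c"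
  define T where "T = tcoord_inv Q A c"
  define s where "s = tcoord c w"
  define G where "G = F \<circ> map_prod id T"
  have charts: "is_chart Q d" if "d \<in> A" for d
    using assms(1) that by (simp add: smooth_manifold_def)
  \<comment> \<open>Openness of \<open>U\<close> supplies this inclusion, which puts
    \<open>w\<close> in the set over which \<open>tcoord_inv\<close> inverts
    \<open>tcoord\<close>.\<close>
  have "U \<subseteq> tangent_bundle Q A"
    using assms(6) by (simp add: openin_tangent_topology[OF charts])
  then have "w \<in> tangent_bundle Q A"
    using w ..
  then have Ts: "T s = w"
    unfolding T_def s_def by (rule tcoord_inv_tcoord[OF charts[OF c] c _ wc])
  have "(\<iota> w, s) \<in> map_prod id (tcoord c) ` {(y, w) \<in> D. fst w \<in> fst c}"
    by (rule image_eqI[of _ _ "(\<iota> w, w)"]) (simp_all add: s_def assms(7) w wc)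
  moreover have "smooth_on (map_prod id (tcoord c) ` {(y, w) \<in> D. fst w \<in> fst c}) G"
    using assms(3) c by (simp add: smooth_on_RnTQ_def G_def T_def)
  ultimately have "G differentiable (at (\<iota> w, s))"
    by (rule smooth_on_imp_differentiable[rotated])
  then obtain G' where G: "(G has_derivative G') (at (\<iota> w, s))"
    unfolding differentiable_def ..
  have "s \<in> tcoord c ` {w \<in> U. fst w \<in> fst c}"
    using w wc by (simp add: s_def)
  moreover have "smooth_on (tcoord c ` {w \<in> U. fst w \<in> fst c}) (\<iota> \<circ> T)"
    using assms(8) c by (simp add: smooth_on_TQ_def T_def)
  ultimately have "(\<iota> \<circ> T) differentiable (at s)"
    by (rule smooth_on_imp_differentiable[rotated])
  then obtain J' where J: "((\<iota> \<circ> T) has_derivative J') (at s)"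
    unfolding differentiable_def ..
  have \<mu>: "G' (axis a 1, 0) = \<mu> $ a" for a
    using partial_a_chart[of Q A c w F G' "\<iota> w" a] Ts G assms(9)[OF w, of a]
    by (simp add: G_def T_def s_def)
  \<comment> \<open>Since \<open>T s = w\<close>, the point
    \<open>((\<iota> \<circ> T) s, s)\<close> is \<open>(\<iota> w, s)\<close>, where
    \<open>G'\<close> is the derivative of \<open>G\<close>.\<close>
  have "((\<lambda>s. G ((\<iota> \<circ> T) s, s) - (\<Sum>a\<in>UNIV. \<mu> $ a * (\<iota> \<circ> T) s $ a)) has_derivative
      (\<lambda>h. G' (0, h))) (at s)"
    by (rule has_derivative_legendre[OF _ J \<mu>]) (simp add: Ts G)
  moreover have "(\<lambda>s. G ((\<iota> \<circ> T) s, s) - (\<Sum>a\<in>UNIV. \<mu> $ a * (\<iota> \<circ> T) s $ a)) = Routhian F \<mu> \<iota> \<circ> T"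
    by (auto simp: G_def Routhian_def)
  \<comment> \<open>The three slots of \<open>(0, 0, i)\<close> are the directions of y^a, of the
    base point x and of the fibre coordinate y^i.\<close>
  ultimately have R: "partial_i Q A c i (Routhian F \<mu> \<iota>) w = G' (0, 0, i)" for i
    unfolding T_def s_def by (intro partial_i_chart) simp
  \<comment> \<open>The y^i-derivatives in \<open>Delta_M\<close> hold y^a fixed. Freezing the first
    argument at \<open>\<iota> w\<close> gives the same linear map
    \<open>h \<mapsto> G' (0, h)\<close> as for the Routhian.\<close>
  have "((\<lambda>s. (\<iota> w, s)) has_derivative (\<lambda>h. (0, h))) (at s)"
    by (intro has_derivative_Pair has_derivative_const has_derivative_ident)
  then have "((\<lambda>s. G (\<iota> w, s)) has_derivative (\<lambda>h. G' (0, h))) (at s)"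
    by (rule has_derivative_compose) (rule G)
  moreover have "(\<lambda>s. G (\<iota> w, s)) = (\<lambda>w'. F (\<iota> w, w')) \<circ> T"
    by (auto simp: G_def)
  ultimately have "partial_i Q A c i (\<lambda>w'. F (\<iota> w, w')) w = G' (0, 0, i)" for i
    unfolding T_def s_def by (intro partial_i_chart) simp
  then have "Delta_M B Q A c F (\<iota> w, w)
      = (\<Sum>a\<in>UNIV. \<mu> $ a * \<iota> w $ a) + Delta_Q B Q A c (Routhian F \<mu> \<iota>) w"
    using assms(9)[OF w] R by (simp add: Delta_M_def Delta_Q_def mult.commute)
  moreover have "Delta_M B Q A c F (\<iota> w, w) = F (\<iota> w, w)"
    using bspec[OF bspec[OF assms(4)[unfolded homogeneous1_on_RnTQ_def] c] assms(7)[OF w]] wc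
    by simp
  ultimately show "Delta_Q B Q A c (Routhian F \<mu> \<iota>) w = Routhian F \<mu> \<iota> w"
    by (simp add: Routhian_def)
qed

end
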